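(* Let $U_5=\{L(\alpha)\in CE(\mu_7): b=0,\ b_{1,4}\neq0,\ b_{1,1}\neq0\}$, and for $\alpha=(b_{0,0},b_{0,1},b_{1,1},b_{1,2},b_{1,4},b)$ put $\Delta=b_{0,1}^2-4b_{0,0}b_{1,1}$ (and $\Delta'=b_{0,1}'^2-4b_{0,0}'b_{1,1}'$ for $\alpha'$). (1) Two algebras $L(\alpha)$ and $L(\alpha')$ from $U_5$ are isomorphic if and only if $$\left(\frac{b_{1,4}}{b_{1,1}}\right)^{10}\Delta^3=\left(\frac{b_{1,4}'}{b_{1,1}'}\right)^{10}\Delta'^3.$$ (2) For any $\lambda\in\mathbb{C}$ there exists $L(\alpha)\in U_5$ with $\left(\frac{b_{1,4}}{b_{1,1}}\right)^{10}\Delta^3=\lambda$. Then the algebras from $U_5$ can be parameterized as $L(\lambda,0,1,0,1,0)$, $\lambda\in\mathbb{C}$; that is, every algebra in $U_5$ is isomorphic to $L(\lambda,0,1,0,1,0)$ for some $\lambda\in\mathbb{C}$.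
   Context: A Leibniz algebra over $\mathbb{C}$ is a complex vector space with a bilinear bracket satisfying $[x,[y,z]]=[[x,y],z]-[[x,z],y]$. $CE(\mu_7)$ (one-dimensional Leibniz central extensions of the 7-dimensional naturally graded filiform Lie algebra $\mu_7$) is the class of the 8-dimensional complex Leibniz algebras $L(\alpha)$, $\alpha=(b_{0,0},b_{0,1},b_{1,1},b_{1,2},b_{1,4},b)$ with $b_{i,j}\in\mathbb{C}$, $b\in\{0,1\}$, with basis $e_0,\dots,e_7$ and brackets $[e_i,e_0]=e_{i+1}$ ($1\le i\le 6$), $[e_0,e_i]=-e_{i+1}$ ($2\le i\le 6$), $[e_0,e_0]=b_{0,0}e_7$, $[e_0,e_1]=-e_2+b_{0,1}e_7$, $[e_1,e_1]=b_{1,1}e_7$, $[e_1,e_2]=-[e_2,e_1]=b_{1,2}e_7$, $[e_1,e_4]=-[e_4,e_1]=b_{1,4}e_7$, $[e_2,e_3]=-[e_3,e_2]=-b_{1,4}e_7$, $[e_1,e_6]=-[e_6,e_1]=-b\,e_7$, $[e_2,e_5]=-[e_5,e_2]=b\,e_7$, $[e_3,e_4]=-[e_4,e_3]=-b\,e_7$, all other brackets of basis vectors being zero. Isomorphic means isomorphic as Leibniz algebras. *)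

theory Defs
  imports "HOL-Analysis.Analysis"
begin

locale leibniz_algebra = vector_space scale
  for scale :: "complex \<Rightarrow> 'a::ab_group_add \<Rightarrow> 'a" +
  fixes br :: "'a \<Rightarrow> 'a \<Rightarrow> 'a"
  assumes linear_left: "Vector_Spaces.linear scale scale (\<lambda>x. br x y)"
    and linear_right: "Vector_Spaces.linear scale scale (br x)"
    and leibniz: "br x (br y z) = br (br x y) z - br (br x z) y"

definition leibniz_isomorphic ::
  "(complex \<Rightarrow> 'a::ab_group_add \<Rightarrow> 'a) \<Rightarrow> ('a \<Rightarrow> 'a \<Rightarrow> 'a) \<Rightarrow>
   (complex \<Rightarrow> 'b::ab_group_add \<Rightarrow> 'b) \<Rightarrow> ('b \<Rightarrow> 'b \<Rightarrow> 'b) \<Rightarrow> bool" where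
  "leibniz_isomorphic s1 br1 s2 br2 \<longleftrightarrow>
     (\<exists>f. Vector_Spaces.linear s1 s2 f \<and> bij f \<and> (\<forall>x y. f (br1 x y) = br2 (f x) (f y)))"

datatype ce_param =
  CE_Param (b00: complex) (b01: complex) (b11: complex) (b12: complex) (b14: complex) (bb: complex)

definition e :: "nat \<Rightarrow> complex^8" where
  "e i = axis (of_nat i) 1"

text \<open>The value \<open>[e\<^sub>i, e\<^sub>j]\<close> in \<open>L(\<alpha>)\<close>.\<close>

definition basis_br :: "ce_param \<Rightarrow> nat \<Rightarrow> nat \<Rightarrow> complex^8" where
  "basis_br \<alpha> i j =
    (if j = 0 \<and> i \<in> {1..6} then e (i + 1)
     else if i = 0 \<and> j \<in> {2..6} then - e (j + 1)
     else if (i, j) = (0, 0) then b00 \<alpha> *s e 7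
     else if (i, j) = (0, 1) then - e 2 + b01 \<alpha> *s e 7
     else if (i, j) = (1, 1) then b11 \<alpha> *s e 7
     else if (i, j) = (1, 2) then b12 \<alpha> *s e 7
     else if (i, j) = (2, 1) then - (b12 \<alpha> *s e 7)
     else if (i, j) = (1, 4) then b14 \<alpha> *s e 7
     else if (i, j) = (4, 1) then - (b14 \<alpha> *s e 7)
     else if (i, j) = (2, 3) then - (b14 \<alpha> *s e 7)
     else if (i, j) = (3, 2) then b14 \<alpha> *s e 7
     else if (i, j) = (1, 6) then - (bb \<alpha> *s e 7)
     else if (i, j) = (6, 1) then bb \<alpha> *s e 7
     else if (i, j) = (2, 5) then bb \<alpha> *s e 7
     else if (i, j) = (5, 2) then - (bb \<alpha> *s e 7)
     else if (i, j) = (3, 4) then - (bb \<alpha> *s e 7)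
     else if (i, j) = (4, 3) then bb \<alpha> *s e 7
     else 0)"

text \<open>The bracket of \<open>L(\<alpha>)\<close>, on the underlying vector space \<open>complex^8\<close>; the coordinate
  of \<open>x\<close> along \<open>e i\<close> is \<open>x $ of_nat i\<close>.\<close>

definition L :: "ce_param \<Rightarrow> complex^8 \<Rightarrow> complex^8 \<Rightarrow> complex^8" where
  "L \<alpha> x y = (\<Sum>i<8. \<Sum>j<8. (x $ of_nat i * y $ of_nat j) *s basis_br \<alpha> i j)"

abbreviation L_isomorphic :: "ce_param \<Rightarrow> ce_param \<Rightarrow> bool" where
  "L_isomorphic \<alpha> \<alpha>' \<equiv> leibniz_isomorphic vector_scalar_mult (L \<alpha>) vector_scalar_mult (L \<alpha>')"

text \<open>The structure constants determine \<open>\<alpha>\<close>, so the class \<open>CE(\<mu>\<^sub>7)\<close> and its subclasses are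
  given by sets of parameters.\<close>

definition CE_mu7 :: "ce_param set" where
  "CE_mu7 = {\<alpha>. bb \<alpha> \<in> {0, 1}}"

definition U5 :: "ce_param set" where
  "U5 = {\<alpha> \<in> CE_mu7. bb \<alpha> = 0 \<and> b14 \<alpha> \<noteq> 0 \<and> b11 \<alpha> \<noteq> 0}"

definition \<Delta> :: "ce_param \<Rightarrow> complex" where
  "\<Delta> \<alpha> = (b01 \<alpha>)\<^sup>2 - 4 * b00 \<alpha> * b11 \<alpha>"

lemma L_nth:
  "L \<alpha> x y $ 0 = 0"
  "L \<alpha> x y $ 1 = 0"
  "L \<alpha> x y $ 2 = x $ 1 * y $ 0 - x $ 0 * y $ 1"
  "L \<alpha> x y $ 3 = x $ 2 * y $ 0 - x $ 0 * y $ 2"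
  "L \<alpha> x y $ 4 = x $ 3 * y $ 0 - x $ 0 * y $ 3"
  "L \<alpha> x y $ 5 = x $ 4 * y $ 0 - x $ 0 * y $ 4"
  "L \<alpha> x y $ 6 = x $ 5 * y $ 0 - x $ 0 * y $ 5"
  "L \<alpha> x y $ 7 = x $ 6 * y $ 0 - x $ 0 * y $ 6
     + b00 \<alpha> * (x $ 0 * y $ 0) + b01 \<alpha> * (x $ 0 * y $ 1) + b11 \<alpha> * (x $ 1 * y $ 1)
     + b12 \<alpha> * (x $ 1 * y $ 2 - x $ 2 * y $ 1)
     + b14 \<alpha> * (x $ 1 * y $ 4 - x $ 4 * y $ 1 - x $ 2 * y $ 3 + x $ 3 * y $ 2)
     + bb \<alpha> * (x $ 6 * y $ 1 - x $ 1 * y $ 6 + x $ 2 * y $ 5 - x $ 5 * y $ 2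
         + x $ 4 * y $ 3 - x $ 3 * y $ 4)"
proof -
  have sum8: "(\<Sum>i<8::nat. f i) = f 0 + f 1 + f 2 + f 3 + f 4 + f 5 + f 6 + f 7"
    for f :: "nat \<Rightarrow> complex^8"
    by (simp add: lessThan_nat_numeral lessThan_Suc ac_simps)
  define r where "r i = (\<Sum>j<8. (x $ of_nat i * y $ of_nat j) *s basis_br \<alpha> i j)" for i
  have L: "L \<alpha> x y = r 0 + r 1 + r 2 + r 3 + r 4 + r 5 + r 6 + r 7"
    by (simp only: L_def r_def sum8)
  note row = r_def sum8 basis_br_def
  have r: "r 0 = (x$0 * y$0) *s (b00 \<alpha> *s e 7) + (x$0 * y$1) *s (- e 2 + b01 \<alpha> *s e 7)
      + (x$0 * y$2) *s - e 3 + (x$0 * y$3) *s - e 4 + (x$0 * y$4) *s - e 5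
      + (x$0 * y$5) *s - e 6 + (x$0 * y$6) *s - e 7"
    "r 1 = (x$1 * y$0) *s e 2 + (x$1 * y$1) *s (b11 \<alpha> *s e 7)
      + (x$1 * y$2) *s (b12 \<alpha> *s e 7) + (x$1 * y$4) *s (b14 \<alpha> *s e 7)
      + (x$1 * y$6) *s - (bb \<alpha> *s e 7)"
    "r 2 = (x$2 * y$0) *s e 3 + (x$2 * y$1) *s - (b12 \<alpha> *s e 7)
      + (x$2 * y$3) *s - (b14 \<alpha> *s e 7) + (x$2 * y$5) *s (bb \<alpha> *s e 7)"
    "r 3 = (x$3 * y$0) *s e 4 + (x$3 * y$2) *s (b14 \<alpha> *s e 7)
      + (x$3 * y$4) *s - (bb \<alpha> *s e 7)"
    "r 4 = (x$4 * y$0) *s e 5 + (x$4 * y$1) *s - (b14 \<alpha> *s e 7)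
      + (x$4 * y$3) *s (bb \<alpha> *s e 7)"
    "r 5 = (x$5 * y$0) *s e 6 + (x$5 * y$2) *s - (bb \<alpha> *s e 7)"
    "r 6 = (x$6 * y$0) *s e 7 + (x$6 * y$1) *s (bb \<alpha> *s e 7)"
    "r 7 = 0"
    by (simp_all add: row flip: numeral_2_eq_2)
  have e_nth: "e i $ k = (if k = of_nat i then 1 else 0)" for i k
    by (auto simp: e_def axis_def)
  show "L \<alpha> x y $ 0 = 0" "L \<alpha> x y $ 1 = 0" by (simp_all add: L r e_nth del: One_nat_def)
  show "L \<alpha> x y $ 2 = x $ 1 * y $ 0 - x $ 0 * y $ 1"
    by (simp add: L r e_nth del: One_nat_def) (simp add: algebra_simps)?
  show "L \<alpha> x y $ 3 = x $ 2 * y $ 0 - x $ 0 * y $ 2"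
    by (simp add: L r e_nth del: One_nat_def) (simp add: algebra_simps)?
  show "L \<alpha> x y $ 4 = x $ 3 * y $ 0 - x $ 0 * y $ 3"
    by (simp add: L r e_nth del: One_nat_def) (simp add: algebra_simps)?
  show "L \<alpha> x y $ 5 = x $ 4 * y $ 0 - x $ 0 * y $ 4"
    by (simp add: L r e_nth del: One_nat_def) (simp add: algebra_simps)?
  show "L \<alpha> x y $ 6 = x $ 5 * y $ 0 - x $ 0 * y $ 5"
    by (simp add: L r e_nth del: One_nat_def) (simp add: algebra_simps)?
  show "L \<alpha> x y $ 7 = x $ 6 * y $ 0 - x $ 0 * y $ 6
     + b00 \<alpha> * (x $ 0 * y $ 0) + b01 \<alpha> * (x $ 0 * y $ 1) + b11 \<alpha> * (x $ 1 * y $ 1)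
     + b12 \<alpha> * (x $ 1 * y $ 2 - x $ 2 * y $ 1)
     + b14 \<alpha> * (x $ 1 * y $ 4 - x $ 4 * y $ 1 - x $ 2 * y $ 3 + x $ 3 * y $ 2)
     + bb \<alpha> * (x $ 6 * y $ 1 - x $ 1 * y $ 6 + x $ 2 * y $ 5 - x $ 5 * y $ 2
         + x $ 4 * y $ 3 - x $ 3 * y $ 4)"
    by (simp add: L r e_nth del: One_nat_def) (simp add: algebra_simps)?
qed

lemma forall_8: "(\<forall>i::8. P i) \<longleftrightarrow> P 0 \<and> P 1 \<and> P 2 \<and> P 3 \<and> P 4 \<and> P 5 \<and> P 6 \<and> P 7"
proof -
  have "i \<in> {0, 1, 2, 3, 4, 5, 6, 7}" for i :: 8
  proof (cases i rule: bit0_cases)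
    case (of_int z)
    then have "z \<in> {0, 1, 2, 3, 4, 5, 6, 7}" by auto
    then show ?thesis using of_int(1) by auto
  qed
  then have "(UNIV :: 8 set) = {0, 1, 2, 3, 4, 5, 6, 7}" by blast
  then have "(\<forall>i::8. P i) \<longleftrightarrow> (\<forall>i\<in>{0, 1, 2, 3, 4, 5, 6, 7}. P i)" by (metis UNIV_I)
  then show ?thesis by (simp only: ball_simps simp_thms)
qed

lemma e_nth: "i < 8 \<Longrightarrow> k < 8 \<Longrightarrow> e i $ of_nat k = (if k = i then 1 else 0)"
proof -
  assume "i < 8" "k < 8"
  then have "i \<in> {0, 1, 2, 3, 4, 5, 6, 7}" "k \<in> {0, 1, 2, 3, 4, 5, 6, 7}" by auto
  then show ?thesis by (auto simp: e_def axis_def)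
qed

lemma L_basis:
  assumes "i < 8" "j < 8"
  shows "L \<alpha> (e i) (e j) = basis_br \<alpha> i j"
proof -
  have "L \<alpha> (e i) (e j) = (\<Sum>k<8. \<Sum>l<8. if l = j then if k = i then basis_br \<alpha> k l else 0 else 0)"
    unfolding L_def using assms by (intro sum.cong) (auto simp: e_nth)
  also have "\<dots> = basis_br \<alpha> i j" using assms by (simp add: sum.delta)
  finally show ?thesis .
qed

lemma leibniz_algebra_L: "leibniz_algebra vector_scalar_mult (L \<alpha>)"
proof -
  have "L \<alpha> (x + y) z = L \<alpha> x z + L \<alpha> y z" "L \<alpha> z (x + y) = L \<alpha> z x + L \<alpha> z y" for x y z
    by (simp_all add: vec_eq_iff forall_8 L_nth ring_distribs)
  moreover have "L \<alpha> (c *s x) z = c *s L \<alpha> x z" "L \<alpha> z (c *s x) = c *s L \<alpha> z x" for c x z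
    by (simp_all only: vec_eq_iff forall_8 L_nth vector_smult_component)
      (simp_all add: algebra_simps)
  moreover have "L \<alpha> x (L \<alpha> y z) = L \<alpha> (L \<alpha> x y) z - L \<alpha> (L \<alpha> x z) y" for x y z
    unfolding vec_eq_iff forall_8 L_nth vector_minus_component
    by (intro conjI; simp only: algebra_simps mult_zero_left mult_zero_right minus_zero
        add_0_left add_0_right diff_zero)
  ultimately show ?thesis
    by (intro leibniz_algebra.intro leibniz_algebra_axioms.intro vec.vector_space_axioms)
      (auto simp: Vector_Spaces.linear_iff vec.vector_space_axioms)
qed

lemma CE_Param_U5: "CE_Param l 0 1 0 1 0 \<in> U5"
  by (simp add: U5_def CE_mu7_def)

end

theory Submission
  imports Defs
begin

text \<open>The algebra is generated by \<open>e\<^sub>0\<close> and \<open>e\<^sub>1\<close>, so an isomorphism \<open>f\<close> is determined by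
  \<open>f e\<^sub>0 = t e\<^sub>0 + a e\<^sub>1 + \<dots>\<close> and \<open>f e\<^sub>1\<close>. As \<open>[e\<^sub>2, e\<^sub>1]\<close> is a multiple of \<open>e\<^sub>7\<close>,
  \<open>f e\<^sub>1 = s e\<^sub>1 + \<dots>\<close> has no \<open>e\<^sub>0\<close>-component, and \<open>f e\<^sub>7 = s t\<^sup>6 e\<^sub>7\<close>. Comparing the coefficients of
  \<open>e\<^sub>7\<close> gives \<open>\<Delta>' = t\<^sup>1\<^sup>0 \<Delta>\<close> and \<open>b\<^sub>1\<^sub>4 / b\<^sub>1\<^sub>1 = t\<^sup>3 b'\<^sub>1\<^sub>4 / b'\<^sub>1\<^sub>1\<close>, whence the invariant.
  Conversely, equal invariants provide such a \<open>t\<close>, after which \<open>s\<close>, \<open>a\<close> and the \<open>e\<^sub>3\<close>-coefficient of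
  \<open>f e\<^sub>1\<close> solve the equations for \<open>b\<^sub>1\<^sub>1\<close>, \<open>b\<^sub>0\<^sub>1\<close> and \<open>b\<^sub>1\<^sub>2\<close>, and the equations for \<open>b\<^sub>1\<^sub>4\<close> and
  \<open>b\<^sub>0\<^sub>0\<close> then hold automatically.\<close>

lemma leibniz_isomorphicE:
  assumes "L_isomorphic \<alpha> \<alpha>'"
  obtains f where "\<And>x y. f (x - y) = f x - f y" "\<And>c x. f (c *s x) = c *s f x" "inj f"
    "\<And>x y. f (L \<alpha> x y) = L \<alpha>' (f x) (f y)"
proof -
  obtain f where f: "Vector_Spaces.linear (*s) (*s) f" "bij f"
      "\<And>x y. f (L \<alpha> x y) = L \<alpha>' (f x) (f y)"
    using assms unfolding leibniz_isomorphic_def by blast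
  show thesis
  proof
    show "f (x - y) = f x - f y" for x y using f(1) by (rule vec.linear_diff)
    show "f (c *s x) = c *s f x" for c x using f(1) by (rule vec.linear_scale)
  qed (use f bij_is_inj in auto)
qed

text \<open>Here \<open>t\<close> and \<open>a\<close> are the coordinates of \<open>f (e 0)\<close>
  along \<open>e 0\<close> and \<open>e 1\<close>, and \<open>s\<close> is that of
  \<open>f (e 1)\<close> along \<open>e 1\<close>. The relations come from the
  \<open>e 7\<close>-coordinate of the images of \<open>[e\<^sub>1, e\<^sub>1]\<close>,
  \<open>[e\<^sub>2, e\<^sub>3]\<close>,
  \<open>[e\<^sub>0, e\<^sub>1] + [e\<^sub>1, e\<^sub>0]\<close> and
  \<open>[e\<^sub>0, e\<^sub>0]\<close>.\<close>

lemma L_isomorphic_imp_relations: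
  assumes iso: "L_isomorphic \<alpha> \<alpha>'" and b: "bb \<alpha> = 0" "bb \<alpha>' = 0"
  obtains t s a where "t \<noteq> 0" "s \<noteq> 0"
    "b11 \<alpha> * t ^ 6 = b11 \<alpha>' * s"
    "b14 \<alpha> * t ^ 3 = b14 \<alpha>' * s"
    "b01 \<alpha> * t ^ 6 = b01 \<alpha>' * t + 2 * b11 \<alpha>' * a"
    "b00 \<alpha> * (s * t ^ 6) = b00 \<alpha>' * t\<^sup>2 + b01 \<alpha>' * t * a + b11 \<alpha>' * a\<^sup>2"
proof -
  obtain f where f: "\<And>x y. f (x - y) = f x - f y" "\<And>c x. f (c *s x) = c *s f x" "inj f"
    "\<And>x y. f (L \<alpha> x y) = L \<alpha>' (f x) (f y)"
    using leibniz_isomorphicE [OF iso] by blast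
  have f0: "f 0 = 0" using f(1)[of 0 0] by simp
  have fm: "f (- x) = - f x" for x using f(1)[of 0 x] f0 by simp
  have fa: "f (x + y) = f x + f y" for x y using f(1)[of x "- y"] fm by simp
  define A B where "A = f (e 0)" and "B = f (e 1)"
  have hom: "L \<alpha>' (f (e i)) (f (e j)) = f (basis_br \<alpha> i j)" if "i < 8" "j < 8" for i j
    using f(4)[of "e i" "e j"] L_basis[OF that] by simp
  have f2: "f (e 2) = L \<alpha>' B A" and f3: "f (e 3) = L \<alpha>' (f (e 2)) A"
    and f4: "f (e 4) = L \<alpha>' (f (e 3)) A" and f5: "f (e 5) = L \<alpha>' (f (e 4)) A"
    and f6: "f (e 6) = L \<alpha>' (f (e 5)) A" and f7: "f (e 7) = L \<alpha>' (f (e 6)) A"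
    using hom[of 1 0] hom[of 2 0] hom[of 3 0] hom[of 4 0] hom[of 5 0] hom[of 6 0]
    by (simp_all add: A_def B_def basis_br_def eval_nat_numeral)
  \<comment> \<open>\<open>d\<close> leads \<open>f (e 2)\<close>, and each further bracket with
    \<open>A\<close> multiplies the leading coefficient by \<open>A $ 0\<close>.\<close>
  define d where "d = B $ 1 * A $ 0 - B $ 0 * A $ 1"
  have c2: "f (e 2) $ 0 = 0" "f (e 2) $ 1 = 0" "f (e 2) $ 2 = d"
    by (simp_all add: f2 L_nth d_def)
  have c3: "f (e 3) $ 0 = 0" "f (e 3) $ 1 = 0" "f (e 3) $ 2 = 0" "f (e 3) $ 3 = d * A $ 0"
    by (simp_all add: f3 L_nth c2)
  have c4: "f (e 4) $ 0 = 0" "f (e 4) $ 1 = 0" "f (e 4) $ 2 = 0" "f (e 4) $ 3 = 0"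
      "f (e 4) $ 4 = d * A $ 0 ^ 2"
    by (simp_all add: f4 L_nth c3 power2_eq_square)
  have c5: "f (e 5) $ 0 = 0" "f (e 5) $ 1 = 0" "f (e 5) $ 2 = 0" "f (e 5) $ 3 = 0"
      "f (e 5) $ 4 = 0" "f (e 5) $ 5 = d * A $ 0 ^ 3"
    by (simp_all only: f5 L_nth c4) (simp_all add: eval_nat_numeral)
  have c6: "f (e 6) $ 0 = 0" "f (e 6) $ 1 = 0" "f (e 6) $ 2 = 0" "f (e 6) $ 3 = 0"
      "f (e 6) $ 4 = 0" "f (e 6) $ 5 = 0" "f (e 6) $ 6 = d * A $ 0 ^ 4"
    by (simp_all only: f6 L_nth c5) (simp_all add: eval_nat_numeral)
  have c7: "f (e 7) $ 0 = 0" "f (e 7) $ 1 = 0" "f (e 7) $ 2 = 0" "f (e 7) $ 3 = 0"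
      "f (e 7) $ 4 = 0" "f (e 7) $ 5 = 0" "f (e 7) $ 6 = 0" "f (e 7) $ 7 = d * A $ 0 ^ 5"
    by (simp_all only: f7 L_nth c6 b) (simp_all add: eval_nat_numeral)
  have "e 7 \<noteq> 0" by (simp add: e_def axis_eq_0_iff)
  then have "f (e 7) \<noteq> 0" using f(3) f0 by (metis injD)
  then have nz: "d * A $ 0 ^ 5 \<noteq> 0" using c7 by (auto simp: vec_eq_iff forall_8)
  then have dA: "d \<noteq> 0" "A $ 0 \<noteq> 0" by auto
  \<comment> \<open>The image of a multiple of \<open>e 7\<close> has no
    \<open>e 3\<close>-coordinate, whereas that of \<open>[f e\<^sub>2, B]\<close> is
    \<open>d * B $ 0\<close>.\<close>
  have "L \<alpha>' (f (e 2)) B = f (- (b12 \<alpha> *s e 7))"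
    using hom[of 2 1] by (simp add: B_def basis_br_def)
  then have "L \<alpha>' (f (e 2)) B $ 3 = 0" by (simp add: f fm c7)
  then have B0: "B $ 0 = 0" using dA by (simp add: L_nth c2)
  have B1: "B $ 1 \<noteq> 0" using dA B0 by (auto simp: d_def)
  have d: "d = B $ 1 * A $ 0" by (simp add: d_def B0)
  have "L \<alpha>' B B $ 7 = b11 \<alpha> * (d * A $ 0 ^ 5)"
    using hom[of 1 1] by (simp add: B_def basis_br_def f c7)
  then have r11: "b11 \<alpha> * A $ 0 ^ 6 = b11 \<alpha>' * B $ 1"
    using B1 by (simp add: L_nth B0 b d eval_nat_numeral)
  \<comment> \<open>The low coordinates of both arguments vanish, so a single product of leading
    coefficients survives.\<close>
  have "L \<alpha>' (f (e 2)) (f (e 3)) $ 7 = - (b14 \<alpha> * (d * A $ 0 ^ 5))"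
    using hom[of 2 3] by (simp add: basis_br_def f fm c7)
  then have "- (d * (d * A $ 0) * b14 \<alpha>') = - (b14 \<alpha> * (d * A $ 0 ^ 5))"
    by (simp add: L_nth c2 c3 b mult_ac)
  then have r14: "b14 \<alpha> * A $ 0 ^ 3 = b14 \<alpha>' * B $ 1"
    using B1 dA by (simp add: d eval_nat_numeral mult_ac)
  \<comment> \<open>Adding the bracket in the opposite order cancels \<open>f (e 2)\<close> and
    every skew term; the symmetric \<open>b11 \<alpha>'\<close> term is doubled.\<close>
  have "L \<alpha>' A B = b01 \<alpha> *s f (e 7) - f (e 2)"
    using hom[of 0 1] by (simp add: A_def B_def basis_br_def f fa fm)
  then have "L \<alpha>' A B $ 7 + L \<alpha>' B A $ 7 = b01 \<alpha> * (d * A $ 0 ^ 5)"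
    by (simp add: c7 flip: f2)
  moreover have "L \<alpha>' A B $ 7 + L \<alpha>' B A $ 7
      = B $ 1 * (b01 \<alpha>' * A $ 0 + 2 * b11 \<alpha>' * A $ 1)"
    by (simp add: L_nth B0 b algebra_simps)
  ultimately have r01: "b01 \<alpha> * A $ 0 ^ 6 = b01 \<alpha>' * A $ 0 + 2 * b11 \<alpha>' * A $ 1"
    using B1 by (simp add: d eval_nat_numeral)
  have "L \<alpha>' A A $ 7 = b00 \<alpha> * (d * A $ 0 ^ 5)"
    using hom[of 0 0] by (simp add: A_def basis_br_def f c7)
  then have r00: "b00 \<alpha> * (B $ 1 * A $ 0 ^ 6)
      = b00 \<alpha>' * (A $ 0)\<^sup>2 + b01 \<alpha>' * A $ 0 * A $ 1 + b11 \<alpha>' * (A $ 1)\<^sup>2"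
    by (simp add: L_nth b d eval_nat_numeral mult.assoc)
  show thesis using that[OF dA(2) B1 r11 r14 r01 r00] .
qed

text \<open>Sending \<open>e 0\<close> to \<open>t *s e 0 + a *s e 1\<close> and \<open>e 1\<close>
  to \<open>s *s e 1 + c *s e 3\<close> forces the other images through repeated brackets with
  \<open>A\<close>. The parameters enter only the \<open>e 7\<close>-coordinate. There
  \<open>c\<close> contributes twice to the \<open>b12\<close> equation, through
  \<open>[e\<^sub>1, e\<^sub>4]\<close> and \<open>[e\<^sub>3, e\<^sub>2]\<close>.\<close>

lemma L_isomorphic_if_relations:
  assumes b: "bb \<alpha> = 0" "bb \<alpha>' = 0" and nz: "t \<noteq> 0" "s \<noteq> 0"
    and r11: "b11 \<alpha> * t ^ 6 = b11 \<alpha>' * s"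
    and r14: "b14 \<alpha> * t ^ 3 = b14 \<alpha>' * s"
    and r01: "b01 \<alpha> * t ^ 6 = b01 \<alpha>' * t + 2 * b11 \<alpha>' * a"
    and r00: "b00 \<alpha> * (s * t ^ 6) = b00 \<alpha>' * t\<^sup>2 + b01 \<alpha>' * t * a + b11 \<alpha>' * a\<^sup>2"
    and r12: "b12 \<alpha> * t ^ 5 = b12 \<alpha>' * s + 2 * b14 \<alpha>' * c"
  shows "L_isomorphic \<alpha> \<alpha>'"
proof -
  define A B where "A = t *s e 0 + a *s e 1" and "B = s *s e 1 + c *s e 3"
  define f2 where "f2 = L \<alpha>' B A"
  define f3 where "f3 = L \<alpha>' f2 A"
  define f4 where "f4 = L \<alpha>' f3 A"
  define f5 where "f5 = L \<alpha>' f4 A"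
  define f6 where "f6 = L \<alpha>' f5 A"
  define f7 where "f7 = L \<alpha>' f6 A"
  define f where "f x = x $ 0 *s A + x $ 1 *s B + x $ 2 *s f2 + x $ 3 *s f3 + x $ 4 *s f4
    + x $ 5 *s f5 + x $ 6 *s f6 + x $ 7 *s f7" for x :: "complex^8"
  have A: "A $ 0 = t" "A $ 1 = a" "A $ 2 = 0" "A $ 3 = 0" "A $ 4 = 0" "A $ 5 = 0" "A $ 6 = 0"
      "A $ 7 = 0"
    and B: "B $ 0 = 0" "B $ 1 = s" "B $ 2 = 0" "B $ 3 = c" "B $ 4 = 0" "B $ 5 = 0" "B $ 6 = 0"
      "B $ 7 = 0"
    by (simp_all add: A_def B_def e_def axis_def)
  have f2: "f2 $ 0 = 0" "f2 $ 1 = 0" "f2 $ 2 = s * t" "f2 $ 3 = 0" "f2 $ 4 = c * t"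
    "f2 $ 5 = 0" "f2 $ 6 = 0" "f2 $ 7 = b11 \<alpha>' * s * a"
    by (simp_all add: f2_def L_nth A B b)
  have f3: "f3 $ 0 = 0" "f3 $ 1 = 0" "f3 $ 2 = 0" "f3 $ 3 = s * t^2" "f3 $ 4 = 0"
    "f3 $ 5 = c * t^2" "f3 $ 6 = 0" "f3 $ 7 = - b12 \<alpha>' * s * t * a - b14 \<alpha>' * c * t * a"
    by (simp_all add: f3_def L_nth A f2 b power2_eq_square)
  have f4: "f4 $ 0 = 0" "f4 $ 1 = 0" "f4 $ 2 = 0" "f4 $ 3 = 0" "f4 $ 4 = s * t^3"
    "f4 $ 5 = 0" "f4 $ 6 = c * t^3" "f4 $ 7 = 0"
    by (simp_all add: f4_def L_nth A f3 b eval_nat_numeral)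
  have f5: "f5 $ 0 = 0" "f5 $ 1 = 0" "f5 $ 2 = 0" "f5 $ 3 = 0" "f5 $ 4 = 0"
    "f5 $ 5 = s * t^4" "f5 $ 6 = 0" "f5 $ 7 = c * t^4 - b14 \<alpha>' * s * t^3 * a"
    by (simp_all add: f5_def L_nth A f4 b eval_nat_numeral)
  have f6: "f6 $ 0 = 0" "f6 $ 1 = 0" "f6 $ 2 = 0" "f6 $ 3 = 0" "f6 $ 4 = 0"
    "f6 $ 5 = 0" "f6 $ 6 = s * t^5" "f6 $ 7 = 0"
    by (simp_all add: f6_def L_nth A f5 b eval_nat_numeral)
  have f7: "f7 $ 0 = 0" "f7 $ 1 = 0" "f7 $ 2 = 0" "f7 $ 3 = 0" "f7 $ 4 = 0"
    "f7 $ 5 = 0" "f7 $ 6 = 0" "f7 $ 7 = s * t^6"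
    by (simp_all add: f7_def L_nth A f6 b eval_nat_numeral)
  have f: "f x $ 0 = t * x $ 0" "f x $ 1 = a * x $ 0 + s * x $ 1" "f x $ 2 = s * t * x $ 2"
    "f x $ 3 = c * x $ 1 + s * t^2 * x $ 3" "f x $ 4 = c * t * x $ 2 + s * t^3 * x $ 4"
    "f x $ 5 = c * t^2 * x $ 3 + s * t^4 * x $ 5"
    "f x $ 6 = c * t^3 * x $ 4 + s * t^5 * x $ 6"
    "f x $ 7 = b11 \<alpha>' * s * a * x $ 2 - (b12 \<alpha>' * s * t * a + b14 \<alpha>' * c * t * a) * x $ 3
      + (c * t^4 - b14 \<alpha>' * s * t^3 * a) * x $ 5 + s * t^6 * x $ 7" for x
    by (simp_all add: f_def A B f2 f3 f4 f5 f6 f7 algebra_simps)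
  have lin: "Vector_Spaces.linear (*s) (*s) f"
    by (auto simp: Vector_Spaces.linear_iff vec.vector_space_axioms vec_eq_iff forall_8 f
        algebra_simps)
  \<comment> \<open>\<open>f\<close> is triangular with nonzero diagonal entries \<open>t\<close>,
    \<open>s\<close>, \<open>s * t\<close>, ..., \<open>s * t ^ 6\<close>.\<close>
  have "x = 0" if "f x = 0" for x
    using that nz by (auto simp: vec_eq_iff forall_8 f)
  then have "inj f" using vec.linear_inj_iff_eq_0[OF lin] by blast
  then have bij: "bij f"
    using vec.linear_inj_imp_surj[OF lin] by (simp add: bij_def)
  \<comment> \<open>The relations are rescaled to the factor \<open>s * t ^ 6\<close> by which
    \<open>f\<close> stretches \<open>e 7\<close>.\<close>
  have q11: "s * t ^ 6 * b11 \<alpha> = b11 \<alpha>' * s^2" using r11 by algebra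
  have q14: "s * t ^ 6 * b14 \<alpha> = b14 \<alpha>' * s^2 * t^3" using r14 by algebra
  have q01: "s * t ^ 6 * b01 \<alpha> = b01 \<alpha>' * s * t + 2 * b11 \<alpha>' * s * a" using r01 by algebra
  have q00: "s * t ^ 6 * b00 \<alpha> = b00 \<alpha>' * t\<^sup>2 + b01 \<alpha>' * t * a + b11 \<alpha>' * a\<^sup>2"
    using r00 by algebra
  have q12: "s * t ^ 6 * b12 \<alpha> = b12 \<alpha>' * s^2 * t + 2 * b14 \<alpha>' * s * c * t" using r12 by algebra
  have seven: "f (L \<alpha> x y) $ 7 = L \<alpha>' (f x) (f y) $ 7" for x y
  proof -
    have "s * t^6 * L \<alpha> x y $ 7 = s * t^6 * (x $ 6 * y $ 0 - x $ 0 * y $ 6)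
       + (s * t^6 * b00 \<alpha>) * (x $ 0 * y $ 0) + (s * t^6 * b01 \<alpha>) * (x $ 0 * y $ 1)
       + (s * t^6 * b11 \<alpha>) * (x $ 1 * y $ 1)
       + (s * t^6 * b12 \<alpha>) * (x $ 1 * y $ 2 - x $ 2 * y $ 1)
       + (s * t^6 * b14 \<alpha>) * (x $ 1 * y $ 4 - x $ 4 * y $ 1 - x $ 2 * y $ 3 + x $ 3 * y $ 2)"
      by (simp only: L_nth b) (simp add: distrib_left mult.assoc)
    note scaled = this[unfolded q00 q01 q11 q12 q14]
    show ?thesis
      unfolding f(8)[of "L \<alpha> x y"] scaled
      by (simp only: L_nth b f) (simp add: algebra_simps eval_nat_numeral)
  qed
  have "f (L \<alpha> x y) = L \<alpha>' (f x) (f y)" for x y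
    unfolding vec_eq_iff forall_8
  proof (intro conjI seven)
  qed (simp_all only: L_nth f b, simp_all add: algebra_simps eval_nat_numeral)
  with lin bij show ?thesis unfolding leibniz_isomorphic_def by blast
qed

lemma L_isomorphic_imp_invariant_eq:
  assumes "\<alpha> \<in> U5" "\<alpha>' \<in> U5" and iso: "L_isomorphic \<alpha> \<alpha>'"
  shows "(b14 \<alpha> / b11 \<alpha>) ^ 10 * \<Delta> \<alpha> ^ 3 = (b14 \<alpha>' / b11 \<alpha>') ^ 10 * \<Delta> \<alpha>' ^ 3"
proof -
  have U: "bb \<alpha> = 0" "bb \<alpha>' = 0" "b11 \<alpha> \<noteq> 0" "b11 \<alpha>' \<noteq> 0"
    using assms by (auto simp: U5_def)
  obtain t s a where nz: "t \<noteq> 0" "s \<noteq> 0"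
    and r11: "b11 \<alpha> * t ^ 6 = b11 \<alpha>' * s"
    and r14: "b14 \<alpha> * t ^ 3 = b14 \<alpha>' * s"
    and r01: "b01 \<alpha> * t ^ 6 = b01 \<alpha>' * t + 2 * b11 \<alpha>' * a"
    and r00: "b00 \<alpha> * (s * t ^ 6) = b00 \<alpha>' * t\<^sup>2 + b01 \<alpha>' * t * a + b11 \<alpha>' * a\<^sup>2"
    using L_isomorphic_imp_relations[OF iso U(1,2)] by blast
  have "b14 \<alpha> * b11 \<alpha>' * (s * t ^ 3) = b14 \<alpha>' * b11 \<alpha> * t ^ 3 * (s * t ^ 3)"
    using r11 r14 by algebra
  then have "b14 \<alpha> * b11 \<alpha>' = b14 \<alpha>' * b11 \<alpha> * t ^ 3"
    using nz by simp
  then have q: "b14 \<alpha> / b11 \<alpha> = b14 \<alpha>' / b11 \<alpha>' * t ^ 3"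
    using U by (simp add: field_simps)
  \<comment> \<open>\<Delta> is the discriminant of the binary form giving the
    \<open>e 7\<close>-coordinate of \<open>[x, x]\<close>. The substitution has determinant
    \<open>s * t\<close> and the form is scaled by \<open>s * t ^ 6\<close>, so \<open>(s * t ^
    6)\<^sup>2 * \<Delta> \<alpha> = (s * t)\<^sup>2 * \<Delta> \<alpha>'\<close>.\<close>
  have "t\<^sup>2 * (t ^ 10 * \<Delta> \<alpha>) = t\<^sup>2 * \<Delta> \<alpha>'"
    unfolding \<Delta>_def using r11 r01 r00 by algebra
  then have D: "\<Delta> \<alpha>' = t ^ 10 * \<Delta> \<alpha>" using nz by (metis mult_left_cancel power_not_zero)
  show ?thesis unfolding q D power_mult_distrib by (simp flip: power_mult)
qed

text \<open>For any cube root \<open>t\<close> of \<open>u\<close>, the hypothesis gives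
  \<open>D' = t ^ 10 * D\<close> up to a cube root of unity. Since
  \<open>t ^ 10 = t * u ^ 3\<close>, changing \<open>t\<close> by that root of unity corrects the
  discrepancy.\<close>

lemma exists_common_root:
  fixes u D D' :: complex
  assumes "u \<noteq> 0" and eq: "u ^ 10 * D ^ 3 = D' ^ 3"
  obtains t where "t ^ 3 = u" "D' = t ^ 10 * D"
proof (cases "D = 0")
  case True
  then have "D' = 0" using eq by simp
  moreover obtain t where "t ^ 3 = u" using exists_complex_root[of 3 u] by auto
  ultimately show thesis using True that by simp
next
  case False
  \<comment> \<open>forced by \<open>t = t ^ 10 / (t ^ 3) ^ 3\<close>\<close>
  define t where "t = D' / (D * u ^ 3)"
  have "t ^ 3 = u"
    using eq[symmetric] False \<open>u \<noteq> 0\<close>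
    by (simp add: t_def power_divide power_mult_distrib flip: power_mult)
      (simp add: field_simps flip: power_Suc)
  moreover have "D' = t * u ^ 3 * D" using False \<open>u \<noteq> 0\<close> by (simp add: t_def)
  then have "D' = t ^ 10 * D" unfolding \<open>t ^ 3 = u\<close>[symmetric] by (simp add: eval_nat_numeral)
  ultimately show thesis using that by blast
qed

lemma L_isomorphic_if_invariant_eq:
  assumes "\<alpha> \<in> U5" "\<alpha>' \<in> U5"
    and eq: "(b14 \<alpha> / b11 \<alpha>) ^ 10 * \<Delta> \<alpha> ^ 3 = (b14 \<alpha>' / b11 \<alpha>') ^ 10 * \<Delta> \<alpha>' ^ 3"
  shows "L_isomorphic \<alpha> \<alpha>'"
proof -
  have U: "bb \<alpha> = 0" "bb \<alpha>' = 0" "b11 \<alpha> \<noteq> 0" "b11 \<alpha>' \<noteq> 0" "b14 \<alpha> \<noteq> 0" "b14 \<alpha>' \<noteq> 0"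
    using assms by (auto simp: U5_def)
  define u where "u = (b14 \<alpha> / b11 \<alpha>) / (b14 \<alpha>' / b11 \<alpha>')"
  have "u \<noteq> 0" using U by (simp add: u_def)
  moreover have "u ^ 10 * \<Delta> \<alpha> ^ 3 = \<Delta> \<alpha>' ^ 3"
    unfolding u_def power_divide[of "b14 \<alpha> / b11 \<alpha>"] using eq U by simp
  ultimately obtain t where t: "t ^ 3 = u" and D: "\<Delta> \<alpha>' = t ^ 10 * \<Delta> \<alpha>"
    by (rule exists_common_root)
  have "t \<noteq> 0" using t \<open>u \<noteq> 0\<close> by auto
  define s where "s = b11 \<alpha> * t ^ 6 / b11 \<alpha>'"
  define a where "a = (b01 \<alpha> * t ^ 6 - b01 \<alpha>' * t) / (2 * b11 \<alpha>')"
  define c where "c = (b12 \<alpha> * t ^ 5 - b12 \<alpha>' * s) / (2 * b14 \<alpha>')"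
  have "s \<noteq> 0" using U \<open>t \<noteq> 0\<close> by (simp add: s_def)
  have r11: "b11 \<alpha> * t ^ 6 = b11 \<alpha>' * s" using U by (simp add: s_def)
  have "b14 \<alpha> * b11 \<alpha>' = b14 \<alpha>' * b11 \<alpha> * t ^ 3"
    using U unfolding t u_def by simp
  then have "b11 \<alpha>' * (b14 \<alpha> * t ^ 3) = b11 \<alpha>' * (b14 \<alpha>' * s)"
    using r11 by algebra
  then have r14: "b14 \<alpha> * t ^ 3 = b14 \<alpha>' * s" using U by simp
  have r01: "b01 \<alpha> * t ^ 6 = b01 \<alpha>' * t + 2 * b11 \<alpha>' * a" using U by (simp add: a_def)
  have r12: "b12 \<alpha> * t ^ 5 = b12 \<alpha>' * s + 2 * b14 \<alpha>' * c" using U by (simp add: c_def)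
  \<comment> \<open>Completing the square: the right side is \<open>(2 * b11 \<alpha>' * a + b01
    \<alpha>' * t)\<^sup>2 - t\<^sup>2 * \<Delta> \<alpha>'\<close>, that is,
    \<open>t ^ 12 * ((b01 \<alpha>)\<^sup>2 - \<Delta> \<alpha>)\<close>.\<close>
  have "4 * b11 \<alpha>' * (b00 \<alpha> * (s * t ^ 6))
      = 4 * b11 \<alpha>' * (b00 \<alpha>' * t\<^sup>2 + b01 \<alpha>' * t * a + b11 \<alpha>' * a\<^sup>2)"
    using r11 r01 D unfolding \<Delta>_def by algebra
  then have r00: "b00 \<alpha> * (s * t ^ 6) = b00 \<alpha>' * t\<^sup>2 + b01 \<alpha>' * t * a + b11 \<alpha>' * a\<^sup>2"
    using U by simp
  show ?thesis
    using L_isomorphic_if_relations[OF U(1,2) \<open>t \<noteq> 0\<close> \<open>s \<noteq> 0\<close> r11 r14 r01 r00 r12] .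
qed

text \<open>On this family the invariant is \<open>(- 4 * k) ^ 3\<close>, which takes every complex
  value; this yields both surjectivity and the normal form.\<close>

lemma exists_CE_Param_invariant:
  obtains k where "(b14 (CE_Param k 0 1 0 1 0) / b11 (CE_Param k 0 1 0 1 0)) ^ 10
    * \<Delta> (CE_Param k 0 1 0 1 0) ^ 3 = l"
proof -
  obtain z where "z ^ 3 = l" using exists_complex_root[of 3 l] by auto
  then show thesis using that[of "- z / 4"] by (simp add: \<Delta>_def)
qed

theorem proposition3p13:
  shows "(\<forall>\<alpha>\<in>U5. \<forall>\<alpha>'\<in>U5. L_isomorphic \<alpha> \<alpha>' \<longleftrightarrow>
            (b14 \<alpha> / b11 \<alpha>) ^ 10 * \<Delta> \<alpha> ^ 3 = (b14 \<alpha>' / b11 \<alpha>') ^ 10 * \<Delta> \<alpha>' ^ 3) \<and>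
         (\<forall>l::complex. \<exists>\<alpha>\<in>U5. (b14 \<alpha> / b11 \<alpha>) ^ 10 * \<Delta> \<alpha> ^ 3 = l) \<and>
         (\<forall>\<alpha>\<in>U5. \<exists>l::complex. L_isomorphic \<alpha> (CE_Param l 0 1 0 1 0))"
proof (intro conjI ballI allI)
  show "L_isomorphic \<alpha> \<alpha>' \<longleftrightarrow>
      (b14 \<alpha> / b11 \<alpha>) ^ 10 * \<Delta> \<alpha> ^ 3 = (b14 \<alpha>' / b11 \<alpha>') ^ 10 * \<Delta> \<alpha>' ^ 3"
    if "\<alpha> \<in> U5" "\<alpha>' \<in> U5" for \<alpha> \<alpha>'
    using L_isomorphic_imp_invariant_eq L_isomorphic_if_invariant_eq that by blast
  show "\<exists>\<alpha>\<in>U5. (b14 \<alpha> / b11 \<alpha>) ^ 10 * \<Delta> \<alpha> ^ 3 = l" for l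
    using exists_CE_Param_invariant CE_Param_U5 by metis
  show "\<exists>l. L_isomorphic \<alpha> (CE_Param l 0 1 0 1 0)" if "\<alpha> \<in> U5" for \<alpha>
    using exists_CE_Param_invariant L_isomorphic_if_invariant_eq[OF that CE_Param_U5] by metis
qed

end
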